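(* Let $A\in\mathcal{B}(H)$ be a selfadjoint operator with $\operatorname{sp}(A)\subset[\gamma,\Gamma]$ for some real numbers $\gamma<\Gamma$. Let $h:[\gamma,\Gamma]\to\mathbb{R}_+$ be a non-negative continuous function and let $f,g:[\gamma,\Gamma]\to\mathbb{R}$ be continuous. If $f$ and $g$ are $h$-synchronous on $[\gamma,\Gamma]$, then $$\langle h^2(A)x,x\rangle\,\langle f(A)g(A)x,x\rangle\ \ge\ \langle h(A)g(A)x,x\rangle\,\langle h(A)f(A)x,x\rangle$$ for every $x\in H$ with $\|x\|=1$. If $f$ and $g$ are $h$-asynchronous on $[\gamma,\Gamma]$, then the reverse inequality ($\le$) holds for every $x\in H$ with $\|x\|=1$.
   Context: $(H,\langle\cdot,\cdot\rangle)$ is a complex Hilbert space, $\mathcal{B}(H)$ is the algebra of bounded linear operators on $H$, and $\operatorname{sp}(A)$ is the spectrum of $A$. For a selfadjoint $A$ and a continuous function $f$ on $\operatorname{sp}(A)$, $f(A)$ is defined by the continuous functional calculus; $h^2$ is the pointwise square of $h$. Given a non-negative function $h:[a,b]\to\mathbb{R}_+$, two functions $f,g:[a,b]\to\mathbb{R}$ are called $h$-synchronous (respectively $h$-asynchronous) on $[a,b]$ if $(h(y)f(x)-h(x)f(y))(h(y)g(x)-h(x)g(y))\ge 0$ (respectively $\le 0$) for all $x,y\in[a,b]$. *)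

theory Defs
  imports "HOL-Analysis.Analysis" "HOL-Library.Complex_Order"
begin

(* The order on complex numbers from HOL-Library.Complex_Order is: z \<le> w iff
   Re z \<le> Re w and Im z = Im w. *)

section \<open>Complex Hilbert spaces\<close>

(* The inner product is linear in its first argument. Positive definiteness of cinner is
   contained in cinner_self_norm, since norm is already a norm. *)
class complex_inner_space = real_normed_vector +
  fixes scaleC :: "complex \<Rightarrow> 'a \<Rightarrow> 'a" (infixr "*\<^sub>C" 75)
    and cinner :: "'a \<Rightarrow> 'a \<Rightarrow> complex"
  assumes scaleC_add_right: "c *\<^sub>C (x + y) = c *\<^sub>C x + c *\<^sub>C y"
    and scaleC_add_left: "(c + d) *\<^sub>C x = c *\<^sub>C x + d *\<^sub>C x"
    and scaleC_scaleC: "c *\<^sub>C d *\<^sub>C x = (c * d) *\<^sub>C x"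
    and scaleR_eq_scaleC: "r *\<^sub>R x = complex_of_real r *\<^sub>C x"
    and cinner_commute: "cinner x y = cnj (cinner y x)"
    and cinner_add_left: "cinner (x + y) z = cinner x z + cinner y z"
    and cinner_scaleC_left: "cinner (c *\<^sub>C x) y = c * cinner x y"
    and cinner_self_norm: "cinner x x = complex_of_real ((norm x)\<^sup>2)"

class complex_hilbert_space = complex_inner_space + complete_space

subclass (in complex_hilbert_space) banach ..

lemma norm_scaleC: "norm (c *\<^sub>C x) = cmod c * norm (x :: 'a :: complex_inner_space)"
proof -
  have "cinner (c *\<^sub>C x) (c *\<^sub>C x) = c * cnj (cinner (c *\<^sub>C x) x)"
    by (metis cinner_commute cinner_scaleC_left)
  also have "\<dots> = c * cnj c * cnj (cinner x x)"
    by (simp add: cinner_scaleC_left)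
  also have "\<dots> = complex_of_real ((cmod c * norm x)\<^sup>2)"
    by (simp add: cinner_self_norm complex_norm_square[symmetric] power_mult_distrib
        del: complex_cnj_mult)
  finally have "(norm (c *\<^sub>C x))\<^sup>2 = (cmod c * norm x)\<^sup>2"
    unfolding cinner_self_norm by (simp only: of_real_eq_iff)
  then show ?thesis
    by (simp add: power2_eq_iff_nonneg)
qed

section \<open>Bounded complex-linear operators\<close>

(* The library type of bounded operators consists of the real-linear ones; B(H) is the set of
   those that are complex-linear. The operator norm is the same. *)
definition bounded_operators :: "('a::complex_hilbert_space \<Rightarrow>\<^sub>L 'a) set" where
  "bounded_operators = {T :: 'a \<Rightarrow>\<^sub>L 'a. \<forall>c x. T (c *\<^sub>C x) = c *\<^sub>C T x}"

lift_definition scaleC_op ::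
    "complex \<Rightarrow> ('a::complex_hilbert_space \<Rightarrow>\<^sub>L 'a) \<Rightarrow> ('a \<Rightarrow>\<^sub>L 'a)"
  is "\<lambda>c T x. c *\<^sub>C T x"
proof -
  fix c :: complex and T :: "'a \<Rightarrow> 'a"
  assume T: "bounded_linear T"
  have "bounded_linear (\<lambda>x::'a. c *\<^sub>C x)"
    by (rule bounded_linear_intro[where K = "cmod c"])
      (simp_all add: scaleC_add_right scaleR_eq_scaleC scaleC_scaleC norm_scaleC mult.commute)
  from bounded_linear_compose[OF this T] show "bounded_linear (\<lambda>x. c *\<^sub>C T x)" .
qed

definition is_adjoint ::
    "('a::complex_hilbert_space \<Rightarrow>\<^sub>L 'a) \<Rightarrow> ('a \<Rightarrow>\<^sub>L 'a) \<Rightarrow> bool" where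
  "is_adjoint S T \<longleftrightarrow> (\<forall>x y. cinner (S x) y = cinner x (T y))"

definition selfadjoint :: "('a::complex_hilbert_space \<Rightarrow>\<^sub>L 'a) \<Rightarrow> bool" where
  "selfadjoint A \<longleftrightarrow> is_adjoint A A"

definition sp :: "('a::complex_hilbert_space \<Rightarrow>\<^sub>L 'a) \<Rightarrow> complex set" where
  "sp A = {z. \<not> (\<exists>B\<in>bounded_operators.
      B o\<^sub>L (A - scaleC_op z id_blinfun) = id_blinfun \<and>
      (A - scaleC_op z id_blinfun) o\<^sub>L B = id_blinfun)}"

section \<open>Continuous functional calculus\<close>

(* Phi is a unital isometric *-homomorphism from C(sp A) to B(H) that maps the identity function
   to A. Elements of C(sp A) are represented by total functions that are continuous on sp A; by
   the isometry property, Phi f depends only on the restriction of f to sp A. The element 0 in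
   the supremum matters only for the zero space, where sp A is empty. *)
definition is_functional_calculus ::
    "('a::complex_hilbert_space \<Rightarrow>\<^sub>L 'a) \<Rightarrow> ((complex \<Rightarrow> complex) \<Rightarrow> ('a \<Rightarrow>\<^sub>L 'a)) \<Rightarrow> bool"
  where
  "is_functional_calculus A \<Phi> \<longleftrightarrow>
    (\<forall>f. continuous_on (sp A) f \<longrightarrow> \<Phi> f \<in> bounded_operators) \<and>
    (\<forall>f g. continuous_on (sp A) f \<longrightarrow> continuous_on (sp A) g \<longrightarrow>
       \<Phi> (\<lambda>z. f z + g z) = \<Phi> f + \<Phi> g \<and>
       \<Phi> (\<lambda>z. f z * g z) = \<Phi> f o\<^sub>L \<Phi> g) \<and>
    (\<forall>c f. continuous_on (sp A) f \<longrightarrow> \<Phi> (\<lambda>z. c * f z) = scaleC_op c (\<Phi> f)) \<and>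
    (\<forall>f. continuous_on (sp A) f \<longrightarrow> is_adjoint (\<Phi> f) (\<Phi> (\<lambda>z. cnj (f z)))) \<and>
    (\<forall>f. continuous_on (sp A) f \<longrightarrow>
       norm (\<Phi> f) = Sup (insert 0 ((\<lambda>z. cmod (f z)) ` sp A))) \<and>
    \<Phi> (\<lambda>z. 1) = id_blinfun \<and>
    \<Phi> (\<lambda>z. z) = A"

(* For selfadjoint A the functional calculus exists and is unique on functions continuous on
   sp A, so the choice below is immaterial for those functions. *)
definition functional_calculus ::
    "('a::complex_hilbert_space \<Rightarrow>\<^sub>L 'a) \<Rightarrow> (complex \<Rightarrow> complex) \<Rightarrow> ('a \<Rightarrow>\<^sub>L 'a)" where
  "functional_calculus A = (SOME \<Phi>. is_functional_calculus A \<Phi>)"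

(* f(A) for a function f of a real variable; sp A consists of real numbers when A is selfadjoint. *)
definition apply_real_fun ::
    "(real \<Rightarrow> real) \<Rightarrow> ('a::complex_hilbert_space \<Rightarrow>\<^sub>L 'a) \<Rightarrow> ('a \<Rightarrow>\<^sub>L 'a)" where
  "apply_real_fun f A = functional_calculus A (\<lambda>z. complex_of_real (f (Re z)))"

section \<open>Synchronous functions\<close>

definition h_synchronous_on ::
    "real set \<Rightarrow> (real \<Rightarrow> real) \<Rightarrow> (real \<Rightarrow> real) \<Rightarrow> (real \<Rightarrow> real) \<Rightarrow> bool" where
  "h_synchronous_on S h f g \<longleftrightarrow>
    (\<forall>x\<in>S. \<forall>y\<in>S. (h y * f x - h x * f y) * (h y * g x - h x * g y) \<ge> 0)"

definition h_asynchronous_on ::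
    "real set \<Rightarrow> (real \<Rightarrow> real) \<Rightarrow> (real \<Rightarrow> real) \<Rightarrow> (real \<Rightarrow> real) \<Rightarrow> bool" where
  "h_asynchronous_on S h f g \<longleftrightarrow>
    (\<forall>x\<in>S. \<forall>y\<in>S. (h y * f x - h x * f y) * (h y * g x - h x * g y) \<le> 0)"

end

theory Submission
  imports Defs "HOL-Computational_Algebra.Fundamental_Theorem_Algebra"
begin

text \<open>For a vector \<open>x\<close> the map \<open>u \<mapsto> \<langle>u(A) x, x\<rangle>\<close> is a positive linear functional on the continuous
  real functions on the interval: if \<open>u \<ge> 0\<close>, its value is \<open>(norm (r(A) x))\<^sup>2\<close> with \<open>r = sqrt u\<close>. So the
  operator inequality is an instance of one for positive linear functionals
  (\<open>synchronous_positive_functional\<close>): apply the functional to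
  \<open>(h(s) f(t) - h(t) f(s)) (h(s) g(t) - h(t) g(s)) \<ge> 0\<close> first in \<open>t\<close> and then in \<open>s\<close>. The
  asynchronous case is the synchronous one for \<open>- g\<close>.

  All this uses the algebraic properties of the functional calculus, which is given by a choice
  operator. What takes most of the work is that a functional calculus exists
  (\<open>is_functional_calculus_functional_calculus\<close>). It is constructed from polynomials. The main point is
  that the norm of \<open>p(A)\<close> is the maximum of \<open>\<bar>p\<bar>\<close> on the spectrum:

  \<^item> Let \<open>M\<close> be the norm of \<open>p(A)\<close> and \<open>q = cnj p * p - M\<^sup>2\<close>. As \<open>p(A)\<close> nearly attains its norm on unit
    vectors, \<open>q(A)\<close> is not bounded below (\<open>not_bounded_below_norm_attained\<close>). By the fundamental theorem
    of algebra \<open>q(A)\<close> is a product of factors \<open>A - l\<close>, one of which is then not invertible. Its \<open>l\<close> is a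
    root of \<open>q\<close> in the spectrum, where \<open>\<bar>p(l)\<bar> = M\<close> because \<open>l\<close> is real (\<open>norm_poly_op_attained\<close>).

  \<^item> Conversely, for \<open>l\<close> in the spectrum \<open>A - l\<close> divides \<open>p(A) - p(l)\<close>, which is therefore not
    invertible. Since \<open>T - c\<close> is invertible for \<open>\<bar>c\<bar>\<close> above the norm of \<open>T\<close>, the norm of \<open>p(A)\<close> is at
    least \<open>\<bar>p(l)\<bar>\<close> (\<open>poly_le_norm_poly_op\<close>).

  By the Weierstrass theorem polynomials are uniformly dense in the continuous functions on the
  compact real spectrum, so \<open>p \<mapsto> p(A)\<close> extends by continuity, with its algebraic properties and with
  the norm identity.\<close>

section \<open>Elementary identities in complex Hilbert spaces\<close>

lemma cinner_add_right: "cinner x (y + z) = cinner x y + cinner x (z :: 'a::complex_inner_space)"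
  by (metis cinner_add_left cinner_commute complex_cnj_add)

lemma cinner_scaleC_right: "cinner x (c *\<^sub>C y) = cnj c * cinner x (y :: 'a::complex_inner_space)"
  by (metis cinner_commute cinner_scaleC_left complex_cnj_mult)

lemma minus_eq_scaleC: "- x = (-1) *\<^sub>C (x :: 'a::complex_inner_space)"
  using scaleR_eq_scaleC[of "-1" x] by simp

lemma cinner_minus_left: "cinner (- x) y = - cinner x (y :: 'a::complex_inner_space)"
  unfolding minus_eq_scaleC cinner_scaleC_left by simp

lemma cinner_diff_left: "cinner (x - y) z = cinner x z - cinner y (z :: 'a::complex_inner_space)"
  using cinner_add_left[of x "- y" z] by (simp add: cinner_minus_left)

lemma cinner_diff_right: "cinner z (x - y) = cinner z x - cinner z (y :: 'a::complex_inner_space)"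
  by (metis cinner_diff_left cinner_commute complex_cnj_diff)

lemma bounded_linear_scaleC: "bounded_linear (\<lambda>x::'a::complex_inner_space. c *\<^sub>C x)"
  by (rule bounded_linear_intro[where K = "cmod c"])
    (simp_all add: scaleC_add_right scaleR_eq_scaleC scaleC_scaleC norm_scaleC mult.commute)

lemmas scaleC_diff_right = bounded_linear.linear[OF bounded_linear_scaleC, THEN linear_diff]
lemmas scaleC_zero_right = bounded_linear.linear[OF bounded_linear_scaleC, THEN linear_0]

lemma scaleC_zero_left [simp]: "0 *\<^sub>C x = (0 :: 'a::complex_inner_space)"
  using scaleR_eq_scaleC[of 0 x] by simp

lemma scaleC_minus_left [simp]: "(- c) *\<^sub>C x = - (c *\<^sub>C (x :: 'a::complex_inner_space))"
  using scaleC_add_left[of c "- c" x] by (simp add: eq_neg_iff_add_eq_0 add.commute)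

lemma scaleC_one [simp]: "1 *\<^sub>C x = (x :: 'a::complex_inner_space)"
  using scaleR_eq_scaleC[of 1 x] by simp

lemma norm_diff_squared:
  "(norm (x - y))\<^sup>2 = (norm x)\<^sup>2 - 2 * Re (cinner x y) + (norm (y :: 'a::complex_inner_space))\<^sup>2"
proof -
  have sq: "(norm v)\<^sup>2 = Re (cinner v v)" for v :: 'a
    by (simp add: cinner_self_norm)
  have "Re (cinner y x) = Re (cinner x y)"
    by (metis cinner_commute complex_cnj(1) complex.sel(1) complex_surj cnj.simps(1))
  then show ?thesis
    unfolding sq by (simp add: cinner_diff_left cinner_diff_right)
qed

text \<open>By polarisation the inner product is an expression in norms, hence jointly continuous.\<close>

lemma cinner_polarization:
  fixes x y :: "'a::complex_inner_space"
  shows "cinner x y = Complex (((norm x)\<^sup>2 + (norm y)\<^sup>2 - (norm (x - y))\<^sup>2) / 2)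
    (((norm x)\<^sup>2 + (norm (\<i> *\<^sub>C y))\<^sup>2 - (norm (x - \<i> *\<^sub>C y))\<^sup>2) / 2)"
  by (rule complex_eqI) (simp_all add: norm_diff_squared cinner_scaleC_right)

lemma tendsto_cinner:
  fixes f g :: "'b \<Rightarrow> 'a::complex_inner_space"
  assumes "(f \<longlongrightarrow> a) F" and "(g \<longlongrightarrow> b) F"
  shows "((\<lambda>n. cinner (f n) (g n)) \<longlongrightarrow> cinner a b) F"
  unfolding cinner_polarization
  by (intro tendsto_intros bounded_linear.tendsto[OF bounded_linear_scaleC] assms)
    (simp_all)

section \<open>Invertible operators\<close>

lemmas scaleC_op_apply [simp] = scaleC_op.rep_eq

lemma bounded_operators_iff:
  "T \<in> bounded_operators \<longleftrightarrow> (\<forall>c x. T (c *\<^sub>C x) = c *\<^sub>C T x)"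
  by (simp add: bounded_operators_def)

lemma bounded_operators_scaleC: "T \<in> bounded_operators \<Longrightarrow> T (c *\<^sub>C x) = c *\<^sub>C T x"
  by (simp add: bounded_operators_def)

lemma bounded_operators_id: "id_blinfun \<in> bounded_operators"
  by (simp add: bounded_operators_iff)

lemma bounded_operators_compose:
  "S \<in> bounded_operators \<Longrightarrow> T \<in> bounded_operators \<Longrightarrow> S o\<^sub>L T \<in> bounded_operators"
  by (simp add: bounded_operators_iff)

lemma bounded_operators_add:
  "S \<in> bounded_operators \<Longrightarrow> T \<in> bounded_operators \<Longrightarrow> S + T \<in> bounded_operators"
  by (simp add: bounded_operators_iff blinfun.add_left scaleC_add_right)

lemma bounded_operators_diff:
  "S \<in> bounded_operators \<Longrightarrow> T \<in> bounded_operators \<Longrightarrow> S - T \<in> bounded_operators"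
  by (simp add: bounded_operators_iff blinfun.diff_left scaleC_diff_right)

lemma bounded_operators_scaleC_op:
  "T \<in> bounded_operators \<Longrightarrow> scaleC_op c T \<in> bounded_operators"
  by (simp add: bounded_operators_iff scaleC_scaleC mult.commute)

lemma norm_scaleC_op_le: "norm (scaleC_op c T) \<le> cmod c * norm T"
proof (rule norm_blinfun_bound)
  show "norm (scaleC_op c T x) \<le> cmod c * norm T * norm x" for x
    using mult_left_mono[OF norm_blinfun[of T x] norm_ge_zero[of c]]
    by (simp add: norm_scaleC mult.assoc)
qed simp

lemma bounded_linear_scaleC_op: "bounded_linear (scaleC_op c)"
proof (rule bounded_linear_intro)
  show "scaleC_op c (S + T) = scaleC_op c S + scaleC_op c T" for S T
    by (rule blinfun_eqI) (simp add: blinfun.add_left scaleC_add_right)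
  show "scaleC_op c (r *\<^sub>R T) = r *\<^sub>R scaleC_op c T" for r T
    by (rule blinfun_eqI) (simp add: blinfun.scaleR_left scaleR_eq_scaleC scaleC_scaleC mult.commute)
  show "norm (scaleC_op c T) \<le> norm T * cmod c" for T
    using norm_scaleC_op_le[of c T] by (simp add: mult.commute)
qed

definition op_invertible :: "('a::complex_hilbert_space \<Rightarrow>\<^sub>L 'a) \<Rightarrow> bool" where
  "op_invertible T \<longleftrightarrow> (\<exists>B\<in>bounded_operators. B o\<^sub>L T = id_blinfun \<and> T o\<^sub>L B = id_blinfun)"

lemma sp_iff: "z \<in> sp A \<longleftrightarrow> \<not> op_invertible (A - scaleC_op z id_blinfun)"
  by (simp add: sp_def op_invertible_def)

lemma op_invertibleI:
  assumes "L \<in> bounded_operators" and L: "L o\<^sub>L T = id_blinfun" and R: "T o\<^sub>L R = id_blinfun"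
  shows "op_invertible T"
proof -
  have "L y = R y" for y
    using L R by (metis blinfun_apply_blinfun_compose id_blinfun.rep_eq id_apply)
  then have "L = R" by (rule blinfun_eqI)
  with assms show ?thesis
    unfolding op_invertible_def by blast
qed

text \<open>The equation \<open>T x - c x = y\<close> is the fixed point equation of the map
  \<open>x \<mapsto> (T x - y) / c\<close>, a contraction when the norm of \<open>T\<close> is below the modulus of \<open>c\<close>. This gives
  the sum of the Neumann series without summing it.\<close>

lemma op_invertible_diff_scaleC:
  assumes T: "T \<in> bounded_operators" and less: "norm T < cmod c"
  shows "op_invertible (T - scaleC_op c id_blinfun)"
proof -
  have c: "c \<noteq> 0" using less norm_ge_zero[of T] by auto
  let ?S = "T - scaleC_op c id_blinfun"
  have S: "?S x = T x - c *\<^sub>C x" for x by (simp add: blinfun.diff_left)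
  have S_lin: "?S \<in> bounded_operators"
    by (intro bounded_operators_diff T bounded_operators_scaleC_op bounded_operators_id)
  have fixp: "inverse c *\<^sub>C (T x - y) = x \<longleftrightarrow> ?S x = y" for x y
  proof -
    have "inverse c *\<^sub>C (T x - y) = x \<longleftrightarrow> T x - y = c *\<^sub>C x"
      using c by (metis scaleC_one scaleC_scaleC left_inverse right_inverse)
    then show ?thesis by (auto simp: S algebra_simps)
  qed
  have ex1: "\<exists>!x. ?S x = y" for y
  proof -
    have "\<exists>!x. inverse c *\<^sub>C (T x - y) = x"
    proof (rule banach_fix_type[of "norm T / cmod c"])
      show "\<forall>x z. dist (inverse c *\<^sub>C (T x - y)) (inverse c *\<^sub>C (T z - y))
          \<le> norm T / cmod c * dist x z"
      proof (intro allI)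
        fix x z
        have "dist (inverse c *\<^sub>C (T x - y)) (inverse c *\<^sub>C (T z - y))
            = norm (inverse c *\<^sub>C T (x - z))"
          by (simp add: dist_norm scaleC_diff_right blinfun.diff_right)
        also have "\<dots> \<le> norm T / cmod c * dist x z"
          using mult_left_mono[OF norm_blinfun[of T "x - z"], of "inverse (cmod c)"]
          using c by (simp add: norm_scaleC norm_divide dist_norm field_simps)
        finally show "dist (inverse c *\<^sub>C (T x - y)) (inverse c *\<^sub>C (T z - y))
            \<le> norm T / cmod c * dist x z" .
      qed
    qed (use less c in \<open>auto simp: divide_simps\<close>)
    then show ?thesis unfolding fixp .
  qed
  define B where "B y = (THE x. ?S x = y)" for y
  have SB: "?S (B y) = y" for y
    unfolding B_def by (rule theI'[OF ex1])
  have BS: "B (?S x) = x" for x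
    using ex1[of "?S x"] SB[of "?S x"] by blast
  have B_eqI: "?S x = y \<Longrightarrow> B y = x" for x y
    using BS by blast
  have B_bound: "norm (B y) \<le> norm y * (1 / (cmod c - norm T))" for y
  proof -
    have "cmod c * norm (B y) = norm (T (B y) - y)"
      using SB[of y] by (simp add: S norm_scaleC[symmetric] algebra_simps)
    also have "\<dots> \<le> norm T * norm (B y) + norm y"
      by (meson norm_triangle_ineq4 norm_blinfun add_right_mono order_trans)
    finally show ?thesis using less by (simp add: field_simps)
  qed
  have B_add: "B (x + y) = B x + B y" for x y
    by (rule B_eqI) (simp only: blinfun.add_right SB)
  have B_scaleC: "B (a *\<^sub>C x) = a *\<^sub>C B x" for a x
    by (rule B_eqI) (simp only: bounded_operators_scaleC[OF S_lin] SB)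
  have bl: "bounded_linear B"
    by (rule bounded_linear_intro[OF B_add _ B_bound]) (simp add: scaleR_eq_scaleC B_scaleC)
  note app = bounded_linear_Blinfun_apply[OF bl]
  show ?thesis
  proof (rule op_invertibleI)
    show "Blinfun B \<in> bounded_operators"
      by (simp add: bounded_operators_iff app B_scaleC)
    show "Blinfun B o\<^sub>L ?S = id_blinfun"
      by (rule blinfun_eqI) (simp only: blinfun_apply_blinfun_compose app BS id_blinfun.rep_eq id_apply)
    show "?S o\<^sub>L Blinfun B = id_blinfun"
      by (rule blinfun_eqI) (simp only: blinfun_apply_blinfun_compose app SB id_blinfun.rep_eq id_apply)
  qed
qed

lemma blinfun_compose_assoc: "(S o\<^sub>L T) o\<^sub>L U = S o\<^sub>L (T o\<^sub>L U)"
  by (rule blinfun_eqI) simp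

lemmas blinfun_compose_zero = bounded_bilinear.zero_right[OF bounded_bilinear_blinfun_compose]

text \<open>If a product of commuting operators is invertible, so are its factors. This serves both for the
  openness of the resolvent set and for the factors of a polynomial in \<open>A\<close>.\<close>

lemma op_invertible_factor:
  assumes U: "op_invertible U" and S: "S \<in> bounded_operators"
    and ST: "S o\<^sub>L T = U" and TS: "T o\<^sub>L S = U"
  shows "op_invertible T"
proof -
  obtain C where C: "C \<in> bounded_operators" "C o\<^sub>L U = id_blinfun" "U o\<^sub>L C = id_blinfun"
    using U by (auto simp: op_invertible_def)
  show ?thesis
  proof (rule op_invertibleI)
    show "C o\<^sub>L S \<in> bounded_operators" by (intro bounded_operators_compose C S)
    show "(C o\<^sub>L S) o\<^sub>L T = id_blinfun" using C ST by (simp add: blinfun_compose_assoc)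
    show "T o\<^sub>L (S o\<^sub>L C) = id_blinfun" using C TS by (simp add: blinfun_compose_assoc[symmetric])
  qed
qed

text \<open>If \<open>B\<close> is the inverse of \<open>A - z\<close>, then \<open>B (A - w) = 1 - (w - z) B\<close>, which is invertible for \<open>w\<close>
  close to \<open>z\<close>.\<close>

lemma closed_sp:
  assumes A: "A \<in> bounded_operators"
  shows "closed (sp A)"
proof -
  have "open (- sp A)"
    unfolding open_dist
  proof
    fix z assume "z \<in> - sp A"
    then obtain B where B: "B \<in> bounded_operators"
      and BA: "B o\<^sub>L (A - scaleC_op z id_blinfun) = id_blinfun"
      and AB: "(A - scaleC_op z id_blinfun) o\<^sub>L B = id_blinfun"
      by (auto simp: sp_def)
    have BA': "B (A x) = x + z *\<^sub>C B x" and AB': "A (B x) = x + z *\<^sub>C B x" for x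
      using arg_cong[OF BA, of "\<lambda>T. blinfun_apply T x"] arg_cong[OF AB, of "\<lambda>T. blinfun_apply T x"]
      by (simp_all add: blinfun.diff_left blinfun.diff_right bounded_operators_scaleC[OF B]
          algebra_simps)
    have "w \<in> - sp A" if w: "dist w z < 1 / (norm B + 1)" for w
    proof -
      have "norm (scaleC_op (w - z) B) \<le> dist w z * norm B"
        using norm_scaleC_op_le[of "w - z" B] by (simp add: dist_norm)
      also have "\<dots> \<le> dist w z * (norm B + 1)"
        by (intro mult_left_mono) auto
      also have "\<dots> < 1"
        using w by (simp add: pos_less_divide_eq add_nonneg_pos)
      finally have inv: "op_invertible (scaleC_op (w - z) B - scaleC_op 1 id_blinfun)"
        by (intro op_invertible_diff_scaleC bounded_operators_scaleC_op B) simp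
      have diff: "(w - z) *\<^sub>C v = w *\<^sub>C v - z *\<^sub>C v" for v :: 'a
        using scaleC_add_left[of "w - z" z v] by simp
      have "op_invertible (A - scaleC_op w id_blinfun)"
      proof (rule op_invertible_factor[OF inv, of "- B"])
        show "- B \<in> bounded_operators"
          using bounded_operators_diff[OF _ B, of 0] by (simp add: bounded_operators_iff scaleC_zero_right)
        show "- B o\<^sub>L (A - scaleC_op w id_blinfun) = scaleC_op (w - z) B - scaleC_op 1 id_blinfun"
          by (rule blinfun_eqI)
            (simp add: blinfun.diff_left blinfun.diff_right blinfun.minus_left BA' diff
              bounded_operators_scaleC[OF B] bounded_operators_scaleC[OF B, of w])
        show "(A - scaleC_op w id_blinfun) o\<^sub>L - B = scaleC_op (w - z) B - scaleC_op 1 id_blinfun"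
          by (rule blinfun_eqI)
            (simp add: blinfun.diff_left blinfun.diff_right blinfun.minus_left blinfun.minus_right AB' diff
              bounded_operators_scaleC[OF A])
      qed
      then show ?thesis by (simp add: sp_iff)
    qed
    then show "\<exists>e>0. \<forall>w. dist w z < e \<longrightarrow> w \<in> - sp A"
      by (intro exI[of _ "1 / (norm B + 1)"]) (auto simp: add_nonneg_pos)
  qed
  then show ?thesis by (simp add: closed_def)
qed

section \<open>Polynomials in an operator\<close>

definition poly_op ::
    "complex poly \<Rightarrow> ('a::complex_hilbert_space \<Rightarrow>\<^sub>L 'a) \<Rightarrow> ('a \<Rightarrow>\<^sub>L 'a)" where
  "poly_op p A = fold_coeffs (\<lambda>a T. scaleC_op a id_blinfun + (A o\<^sub>L T)) p 0"

lemma poly_op_0 [simp]: "poly_op 0 A = 0"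
  by (simp add: poly_op_def)

lemma scaleC_op_0_left [simp]: "scaleC_op 0 T = 0"
  by (rule blinfun_eqI) simp

lemma scaleC_op_1 [simp]: "scaleC_op 1 T = T"
  by (rule blinfun_eqI) simp

lemma poly_op_pCons [simp]: "poly_op (pCons a p) A = scaleC_op a id_blinfun + (A o\<^sub>L poly_op p A)"
  by (cases "p = 0 \<and> a = 0")
    (auto simp: poly_op_def blinfun_compose_zero)

lemma poly_op_pCons_apply: "poly_op (pCons a p) A x = a *\<^sub>C x + A (poly_op p A x)"
  by (simp add: blinfun.add_left)

lemma poly_op_linear: "poly_op [:- l, 1:] A = A - scaleC_op l id_blinfun"
  by (rule blinfun_eqI) (simp add: blinfun.add_left blinfun.diff_left blinfun_compose_zero)

lemma poly_op_const: "poly_op [:c:] A = scaleC_op c id_blinfun"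
  by (simp add: blinfun_compose_zero)

lemma poly_op_X: "poly_op [:0, 1:] A = A"
  by (rule blinfun_eqI) simp

lemma poly_op_mem:
  assumes "A \<in> bounded_operators"
  shows "poly_op p A \<in> bounded_operators"
proof (induction p)
  case 0
  show ?case by (simp add: bounded_operators_iff scaleC_zero_right)
next
  case (pCons a p)
  then show ?case
    by (simp add: bounded_operators_add bounded_operators_compose bounded_operators_scaleC_op
        bounded_operators_id assms)
qed

lemma poly_op_add: "poly_op (p + q) A = poly_op p A + poly_op q A"
proof (rule poly_induct2[of _ p q])
  show "poly_op (0 + 0) A = poly_op 0 A + poly_op 0 A" by simp
next
  fix a b p q
  assume IH: "poly_op (p + q) A = poly_op p A + poly_op q A"
  show "poly_op (pCons a p + pCons b q) A = poly_op (pCons a p) A + poly_op (pCons b q) A"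
    by (rule blinfun_eqI)
      (simp add: blinfun.add_left blinfun.add_right scaleC_add_left IH)
qed

lemma poly_op_smult:
  assumes A: "A \<in> bounded_operators"
  shows "poly_op (smult c p) A = scaleC_op c (poly_op p A)"
proof (induction p)
  case 0
  show ?case by (rule blinfun_eqI) (simp add: scaleC_zero_right)
next
  case (pCons a p)
  show ?case
    by (rule blinfun_eqI)
      (simp add: pCons.IH blinfun.add_left scaleC_add_right scaleC_scaleC bounded_operators_scaleC[OF A])
qed

lemma poly_op_mult:
  assumes A: "A \<in> bounded_operators"
  shows "poly_op (p * q) A = poly_op p A o\<^sub>L poly_op q A"
proof (induction p)
  case 0
  show ?case by (rule blinfun_eqI) simp
next
  case (pCons a p)
  show ?case
    by (rule blinfun_eqI) (simp add: pCons.IH poly_op_add poly_op_smult[OF A] blinfun.add_left)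
qed

lemma poly_op_diff:
  assumes A: "A \<in> bounded_operators"
  shows "poly_op (p - q) A = poly_op p A - poly_op q A"
  using poly_op_add[of "p - q" q A] by simp

lemma poly_op_adjoint:
  assumes A: "A \<in> bounded_operators" and sa: "selfadjoint A"
  shows "cinner (poly_op p A x) y = cinner x (poly_op (map_poly cnj p) A y)"
proof (induction p arbitrary: x y)
  case 0
  show ?case
    using cinner_diff_left[of x x y] cinner_diff_right[of x y y] by simp
next
  case (pCons a p)
  have A_comm: "poly_op q A (A y) = A (poly_op q A y)" for q
  proof -
    have "poly_op q A o\<^sub>L A = poly_op (q * [:0, 1:]) A"
      by (simp only: poly_op_mult[OF A] poly_op_X)
    also have "\<dots> = poly_op ([:0, 1:] * q) A"
      by (rule arg_cong[OF mult.commute])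
    also have "\<dots> = A o\<^sub>L poly_op q A"
      by (simp only: poly_op_mult[OF A] poly_op_X)
    finally show ?thesis
      by (simp only: blinfun_apply_blinfun_compose[symmetric])
  qed
  have map: "map_poly cnj (pCons a p) = pCons (cnj a) (map_poly cnj p)"
    by (simp add: map_poly_pCons)
  have sa': "cinner (A u) v = cinner u (A v)" for u v
    using sa by (simp add: selfadjoint_def is_adjoint_def)
  show ?case
    unfolding map poly_op_pCons_apply
    by (simp only: cinner_add_left cinner_add_right cinner_scaleC_left cinner_scaleC_right sa'
        pCons.IH A_comm complex_cnj_cnj)
qed

section \<open>The norm of a polynomial in a selfadjoint operator\<close>

definition bounded_below :: "('a::real_normed_vector \<Rightarrow>\<^sub>L 'b::real_normed_vector) \<Rightarrow> bool" where
  "bounded_below T \<longleftrightarrow> (\<exists>c>0. \<forall>x. c * norm x \<le> norm (T x))"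

lemma op_invertible_imp_bounded_below:
  assumes "op_invertible T"
  shows "bounded_below T"
proof -
  obtain B where B: "B o\<^sub>L T = id_blinfun"
    using assms by (auto simp: op_invertible_def)
  have "1 / (norm B + 1) * norm x \<le> norm (T x)" for x
  proof -
    have "norm x = norm (B (T x))"
      using B by (metis blinfun_apply_blinfun_compose id_blinfun.rep_eq id_apply)
    also have "\<dots> \<le> (norm B + 1) * norm (T x)"
      using norm_blinfun[of B "T x"] norm_ge_zero[of "T x"] unfolding distrib_right mult_1 by linarith
    finally show ?thesis
      by (simp add: pos_divide_le_eq add_nonneg_pos mult.commute)
  qed
  then show ?thesis
    unfolding bounded_below_def by (intro exI[of _ "1 / (norm B + 1)"]) (auto simp: add_nonneg_pos)
qed

lemma bounded_below_compose:
  assumes "bounded_below S" and "bounded_below T"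
  shows "bounded_below (S o\<^sub>L T)"
proof -
  obtain c d where c: "c > 0" "\<And>x. c * norm x \<le> norm (S x)"
    and d: "d > 0" "\<And>x. d * norm x \<le> norm (T x)"
    using assms by (auto simp: bounded_below_def)
  have "(c * d) * norm x \<le> norm ((S o\<^sub>L T) x)" for x
    using order_trans[OF mult_left_mono[OF d(2)[of x], of c] c(2)[of "T x"]] c(1)
    by (simp add: mult.assoc)
  then show ?thesis
    using c(1) d(1) unfolding bounded_below_def by (intro exI[of _ "c * d"]) auto
qed

text \<open>By the fundamental theorem of algebra a polynomial without roots in the spectrum is a constant
  times a product of linear factors \<open>z - l\<close> with \<open>A - l\<close> invertible.\<close>

lemma poly_op_bounded_below:
  assumes A: "A \<in> bounded_operators" and "q \<noteq> 0" and "\<And>l. l \<in> sp A \<Longrightarrow> poly q l \<noteq> 0"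
  shows "bounded_below (poly_op q A)"
  using assms(2,3)
proof (induction "degree q" arbitrary: q)
  case 0
  then obtain a where q: "q = [:a:]" and a: "a \<noteq> 0"
    by (metis degree_eq_zeroE pCons_0_0)
  show ?case
    unfolding bounded_below_def
    by (intro exI[of _ "cmod a"])
      (use a in \<open>simp add: q norm_scaleC blinfun_compose_zero\<close>)
next
  case (Suc n)
  have "\<not> constant (poly q)"
    using Suc.hyps(2) by (simp add: constant_degree)
  then obtain l where "poly q l = 0"
    using fundamental_theorem_of_algebra by blast
  then obtain r where q: "q = [:- l, 1:] * r"
    by (auto simp: poly_eq_0_iff_dvd)
  have r: "r \<noteq> 0" using q Suc.prems(1) by auto
  have "degree q = Suc (degree r)"
    unfolding q by (subst degree_mult_eq) (use r in auto)
  then have "n = degree r" using Suc.hyps(2) by simp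
  moreover have "poly r z \<noteq> 0" if "z \<in> sp A" for z
    using Suc.prems(2)[OF that] q by auto
  ultimately have 1: "bounded_below (poly_op r A)"
    using Suc.hyps(1) r by blast
  have "l \<notin> sp A"
    using Suc.prems(2) \<open>poly q l = 0\<close> by blast
  then have "bounded_below (poly_op [:- l, 1:] A)"
    by (simp add: poly_op_linear sp_iff op_invertible_imp_bounded_below del: poly_op_pCons)
  from bounded_below_compose[OF this 1] show ?case
    by (simp only: q poly_op_mult[OF A])
qed

text \<open>Write \<open>B = p(A)\<close> and let \<open>M\<close> be its norm. As \<open>B\<close> is normal, the adjoint of \<open>B\<close> has the
  same effect as \<open>B\<close> on norms, so
  \<open>norm ((B\<^sup>* B - M\<^sup>2) x)\<^sup>2 \<le> M\<^sup>4 (norm x)\<^sup>2 - M\<^sup>2 (norm (B x))\<^sup>2\<close>. A lower bound for the left side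
  would bound \<open>B\<close> by a constant smaller than \<open>M\<close>.\<close>

lemma not_bounded_below_norm_attained:
  fixes A :: "'a::complex_hilbert_space \<Rightarrow>\<^sub>L 'a"
  assumes A: "A \<in> bounded_operators" and sa: "selfadjoint A" and nz: "x0 \<noteq> (0 :: 'a)"
    and M: "M = norm (poly_op p A)"
  shows "\<not> bounded_below (poly_op (map_poly cnj p * p - [:complex_of_real (M\<^sup>2):]) A)"
proof
  let ?B = "poly_op p A" and ?C = "poly_op (map_poly cnj p) A"
  let ?Q = "poly_op (map_poly cnj p * p - [:complex_of_real (M\<^sup>2):]) A"
  have cnj_cnj: "map_poly cnj (map_poly cnj p) = p"
    by (rule poly_eqI) (simp add: coeff_map_poly)
  note adj = poly_op_adjoint[OF A sa]
  have comm: "?C (?B x) = ?B (?C x)" for x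
    using poly_op_mult[OF A, of "map_poly cnj p" p] poly_op_mult[OF A, of p "map_poly cnj p"]
    by (metis blinfun_apply_blinfun_compose mult.commute)
  have norm_eq: "norm (?C x) = norm (?B x)" for x
  proof -
    have "cinner (?C x) (?C x) = cinner (?B x) (?B x)"
      using adj[of "map_poly cnj p" x "?C x"] adj[of p x "?B x"] by (simp add: cnj_cnj comm)
    then show ?thesis
      by (simp add: cinner_self_norm)
        (metis norm_ge_zero of_real_eq_iff of_real_power power2_eq_iff_nonneg)
  qed
  have Q: "?Q x = ?C (?B x) - complex_of_real (M\<^sup>2) *\<^sub>C x" for x
    by (simp add: poly_op_diff[OF A] poly_op_mult[OF A] blinfun.diff_left
        blinfun_compose_zero)
  assume "bounded_below ?Q"
  then obtain c where c: "c > 0" "\<And>x. c * norm x \<le> norm (?Q x)"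
    by (auto simp: bounded_below_def)
  have key: "(M * norm (?B x))\<^sup>2 \<le> (M ^ 4 - c\<^sup>2) * (norm x)\<^sup>2" for x
  proof -
    have "(c * norm x)\<^sup>2 \<le> (norm (?Q x))\<^sup>2"
      using c by (intro power_mono) auto
    also have "\<dots> = (norm (?C (?B x)))\<^sup>2 - 2 * M\<^sup>2 * (norm (?B x))\<^sup>2 + M ^ 4 * (norm x)\<^sup>2"
    proof -
      have "cinner (?C (?B x)) x = complex_of_real ((norm (?B x))\<^sup>2)"
        using adj[of "map_poly cnj p" "?B x" x] by (simp add: cnj_cnj cinner_self_norm)
      then show ?thesis
        unfolding Q norm_diff_squared
        by (simp add: cinner_scaleC_right norm_scaleC power_mult_distrib norm_power
            flip: of_real_power)
    qed
    also have "(norm (?C (?B x)))\<^sup>2 \<le> (M * norm (?B x))\<^sup>2"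
      unfolding norm_eq M by (intro power_mono norm_blinfun) simp
    finally show ?thesis by (simp add: power_mult_distrib algebra_simps)
  qed
  define k where "k = M ^ 4 - c\<^sup>2"
  have "0 \<le> k * (norm x0)\<^sup>2"
    using key[of x0] by (metis k_def order_trans zero_le_power2)
  then have k: "k \<ge> 0"
    using nz by (simp add: zero_le_mult_iff)
  have M0: "M \<ge> 0" by (simp add: M)
  have "M * norm (?B x) \<le> sqrt k * norm x" for x
  proof (rule power2_le_imp_le)
    show "(M * norm (?B x))\<^sup>2 \<le> (sqrt k * norm x)\<^sup>2"
      using key[of x] k by (simp add: k_def power_mult_distrib)
  qed (use k in simp)
  then have "norm (M *\<^sub>R ?B) \<le> sqrt k"
    using k M0 by (intro norm_blinfun_bound) (auto simp: blinfun.scaleR_left)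
  then have "M * M \<le> sqrt k"
    using M0 by (simp add: M)
  then have "(M * M)\<^sup>2 \<le> k"
    using k M0 by (metis mult_nonneg_nonneg power_mono real_sqrt_pow2)
  then show False
    using zero_less_power[OF c(1), of 2] by (simp add: k_def power2_eq_square power4_eq_xxxx)
qed

text \<open>The previous lemma applied to the polynomial \<open>z\<close>: the spectrum contains a root of
  \<open>z\<^sup>2 - (norm A)\<^sup>2\<close>.\<close>

lemma sp_nonempty:
  fixes A :: "'a::complex_hilbert_space \<Rightarrow>\<^sub>L 'a"
  assumes A: "A \<in> bounded_operators" and sa: "selfadjoint A" and nz: "x0 \<noteq> (0 :: 'a)"
  shows "sp A \<noteq> {}"
proof
  assume empty: "sp A = {}"
  let ?p = "[:0, 1:] :: complex poly"
  let ?q = "map_poly cnj ?p * ?p - [:complex_of_real ((norm (poly_op ?p A))\<^sup>2):]"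
  have "coeff ?q 2 = 1"
    by (simp add: map_poly_pCons numeral_2_eq_2)
  then have "?q \<noteq> 0" by (metis coeff_0 zero_neq_one)
  then have "bounded_below (poly_op ?q A)"
    by (intro poly_op_bounded_below A) (auto simp: empty)
  then show False
    using not_bounded_below_norm_attained[OF A sa nz refl] by blast
qed

lemma norm_poly_op_attained:
  fixes A :: "'a::complex_hilbert_space \<Rightarrow>\<^sub>L 'a"
  assumes A: "A \<in> bounded_operators" and sa: "selfadjoint A" and nz: "x0 \<noteq> (0 :: 'a)"
    and real: "sp A \<subseteq> \<real>"
  shows "\<exists>l\<in>sp A. cmod (poly p l) = norm (poly_op p A)"
proof -
  define M where "M = norm (poly_op p A)"
  let ?q = "map_poly cnj p * p - [:complex_of_real (M\<^sup>2):]"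
  \<comment> \<open>If \<open>p\<close> is constant, then \<open>?q\<close> may vanish, and any point of the spectrum will do.\<close>
  have "\<exists>l\<in>sp A. poly ?q l = 0"
  proof (cases "?q = 0")
    case True
    then show ?thesis using sp_nonempty[OF A sa nz] by auto
  next
    case False
    then show ?thesis
      using poly_op_bounded_below[OF A False] not_bounded_below_norm_attained[OF A sa nz M_def]
      by blast
  qed
  then obtain l where l: "l \<in> sp A" "poly ?q l = 0" by blast
  have "cnj l = l" using l(1) real by (auto simp: Reals_cnj_iff)
  then have "cnj (poly p l) * poly p l = complex_of_real (M\<^sup>2)"
    using l(2) by simp
  then have "(cmod (poly p l))\<^sup>2 = M\<^sup>2"
    by (metis complex_norm_square mult.commute of_real_eq_iff)
  then show ?thesis
    using l(1) by (auto simp: M_def power2_eq_iff_nonneg)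
qed

text \<open>The upper bound is taken over any \<open>m \<ge> 0\<close> rather than as a supremum, to include the zero space,
  where the spectrum is empty.\<close>

lemma norm_poly_op_le:
  fixes A :: "'a::complex_hilbert_space \<Rightarrow>\<^sub>L 'a"
  assumes A: "A \<in> bounded_operators" and sa: "selfadjoint A" and real: "sp A \<subseteq> \<real>"
    and m: "m \<ge> 0" "\<And>l. l \<in> sp A \<Longrightarrow> cmod (poly p l) \<le> m"
  shows "norm (poly_op p A) \<le> m"
proof (cases "\<exists>x0 :: 'a. x0 \<noteq> 0")
  case True
  then show ?thesis using norm_poly_op_attained[OF A sa _ real] m(2) by metis
next
  case False
  then have "poly_op p A = 0" by (intro blinfun_eqI) simp
  then show ?thesis using m(1) by simp
qed

text \<open>The factor theorem gives \<open>p(A) - p(l) = (A - l) r(A)\<close>; so \<open>p(A) - p(l)\<close> is not invertible when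
  \<open>l\<close> is in the spectrum.\<close>

lemma poly_le_norm_poly_op:
  assumes A: "A \<in> bounded_operators" and l: "l \<in> sp A"
  shows "cmod (poly p l) \<le> norm (poly_op p A)"
proof (rule ccontr)
  assume "\<not> ?thesis"
  then have inv: "op_invertible (poly_op p A - scaleC_op (poly p l) id_blinfun)"
    by (intro op_invertible_diff_scaleC poly_op_mem A) simp
  have "[:- l, 1:] dvd p - [:poly p l:]"
    by (simp add: poly_eq_0_iff_dvd[symmetric])
  then obtain r where r: "p - [:poly p l:] = [:- l, 1:] * r" by blast
  have "poly_op p A - scaleC_op (poly p l) id_blinfun = poly_op (p - [:poly p l:]) A"
    by (simp add: poly_op_diff[OF A] poly_op_const del: poly_op_pCons)
  moreover have "\<dots> = poly_op [:- l, 1:] A o\<^sub>L poly_op r A"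
    by (simp only: r poly_op_mult[OF A])
  moreover have "\<dots> = poly_op r A o\<^sub>L poly_op [:- l, 1:] A"
    by (metis poly_op_mult[OF A] mult.commute)
  ultimately have "op_invertible (A - scaleC_op l id_blinfun)"
    using op_invertible_factor[OF inv poly_op_mem[OF A, of r]] poly_op_linear by metis
  then show False using l by (simp add: sp_iff)
qed

section \<open>Existence of the continuous functional calculus\<close>

lemma compact_sp:
  assumes A: "A \<in> bounded_operators"
  shows "compact (sp A)"
proof -
  have "cmod l \<le> norm A" if "l \<in> sp A" for l
    using poly_le_norm_poly_op[OF A that, of "[:0, 1:]"] by (simp add: poly_op_X del: poly_op_pCons)
  then have "bounded (sp A)" by (auto simp: bounded_iff)
  with closed_sp[OF A] show ?thesis by (simp add: compact_eq_bounded_closed)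
qed

text \<open>On a subset of the real line the real and imaginary parts of \<open>f\<close> are approximated separately.
  A set with interior points would not do, as uniform limits of polynomials are holomorphic there.\<close>

lemma Weierstrass_complex_polynomial:
  fixes f :: "complex \<Rightarrow> complex"
  assumes S: "compact S" "S \<subseteq> \<real>" and f: "continuous_on S f" and e: "e > 0"
  shows "\<exists>p. \<forall>z\<in>S. dist (poly p z) (f z) < e"
proof -
  have S_eq: "z = complex_of_real (Re z)" if "z \<in> S" for z
    using S(2) that by (auto elim!: Reals_cases)
  have K: "compact (Re ` S)"
    by (intro compact_continuous_image S(1) continuous_intros)
  have "complex_of_real ` Re ` S = S"
    using S_eq by (force simp: image_image)
  then have cont: "continuous_on (Re ` S) (\<lambda>r. f (complex_of_real r))"
    using f by (intro continuous_on_compose2[OF f]) (auto intro!: continuous_intros)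
  have real: "\<exists>p. \<forall>z\<in>S. dist (poly p z) (complex_of_real (u (Re z))) < e / 2"
    if u: "continuous_on (Re ` S) u" for u
  proof -
    obtain g where g: "real_polynomial_function g" "\<And>r. r \<in> Re ` S \<Longrightarrow> \<bar>u r - g r\<bar> < e / 2"
      using Stone_Weierstrass_real_polynomial_function[OF K u, of "e / 2"] e by auto
    then obtain a n where a: "g = (\<lambda>r. \<Sum>i\<le>n. a i * r ^ i)"
      by (auto simp: real_polynomial_function_iff_sum)
    let ?p = "\<Sum>i\<le>n. monom (complex_of_real (a i)) i"
    have "poly ?p (complex_of_real r) = complex_of_real (g r)" for r
      by (simp add: a poly_sum poly_monom)
    then have "dist (poly ?p (complex_of_real (Re z))) (complex_of_real (u (Re z))) < e / 2"
      if "z \<in> S" for z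
      using g(2)[of "Re z"] that by (simp add: dist_of_real dist_real_def abs_minus_commute)
    then show ?thesis using S_eq by metis
  qed
  obtain p q where p: "\<And>z. z \<in> S \<Longrightarrow> dist (poly p z) (complex_of_real (Re (f z))) < e / 2"
    and q: "\<And>z. z \<in> S \<Longrightarrow> dist (poly q z) (complex_of_real (Im (f z))) < e / 2"
    using real[of "\<lambda>r. Re (f (complex_of_real r))"] real[of "\<lambda>r. Im (f (complex_of_real r))"]
      cont S_eq by (force intro: continuous_intros)
  have "dist (poly (p + smult \<i> q) z) (f z) < e" if z: "z \<in> S" for z
  proof -
    have "poly (p + smult \<i> q) z - f z = (poly p z - complex_of_real (Re (f z)))
        + \<i> * (poly q z - complex_of_real (Im (f z)))"
      using complex_eq[of "f z"] by (simp add: algebra_simps)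
    then have "dist (poly (p + smult \<i> q) z) (f z)
        \<le> dist (poly p z) (complex_of_real (Re (f z))) + dist (poly q z) (complex_of_real (Im (f z)))"
      unfolding dist_norm
      by (metis norm_triangle_ineq norm_mult norm_ii mult_1)
    then show ?thesis using p[OF z] q[OF z] by simp
  qed
  then show ?thesis by blast
qed

lemma uniform_limit_polynomials:
  fixes f :: "complex \<Rightarrow> complex"
  assumes "compact S" "S \<subseteq> \<real>" "continuous_on S f"
  obtains P where "uniform_limit S (\<lambda>n. poly (P n)) f sequentially"
proof -
  have "\<exists>p. \<forall>z\<in>S. dist (poly p z) (f z) < inverse (real (Suc n))" for n
    by (rule Weierstrass_complex_polynomial[OF assms]) simp
  then obtain P where P: "\<And>n z. z \<in> S \<Longrightarrow> dist (poly (P n) z) (f z) < inverse (real (Suc n))"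
    by metis
  have "uniform_limit S (\<lambda>n. poly (P n)) f sequentially"
  proof (rule uniform_limitI)
    fix e :: real assume "e > 0"
    then have "\<forall>\<^sub>F n in sequentially. inverse (real (Suc n)) < e"
      using order_tendstoD(2)[OF LIMSEQ_inverse_real_of_nat] by blast
    then show "\<forall>\<^sub>F n in sequentially. \<forall>z\<in>S. dist (poly (P n) z) (f z) < e"
      by eventually_elim (use P less_trans in blast)
  qed
  then show ?thesis by (rule that)
qed

text \<open>\<open>poly_limit A f T\<close> expresses \<open>T = f(A)\<close>, as a limit of polynomials in \<open>A\<close>.\<close>

definition poly_limit ::
    "('a::complex_hilbert_space \<Rightarrow>\<^sub>L 'a) \<Rightarrow> (complex \<Rightarrow> complex) \<Rightarrow> ('a \<Rightarrow>\<^sub>L 'a) \<Rightarrow> bool" where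
  "poly_limit A f T \<longleftrightarrow> (\<exists>P. uniform_limit (sp A) (\<lambda>n. poly (P n)) f sequentially \<and>
     (\<lambda>n. poly_op (P n) A) \<longlonglongrightarrow> T)"

lemma poly_limit_poly: "poly_limit A (poly p) (poly_op p A)"
  unfolding poly_limit_def by (intro exI[of _ "\<lambda>_. p"]) (simp add: uniform_limit_const)

context
  fixes A :: "'a::complex_hilbert_space \<Rightarrow>\<^sub>L 'a"
  assumes A: "A \<in> bounded_operators" and sa: "selfadjoint A" and real: "sp A \<subseteq> \<real>"
begin

lemma poly_limit_mem:
  assumes "poly_limit A f T"
  shows "T \<in> bounded_operators"
proof -
  obtain P where P: "(\<lambda>n. poly_op (P n) A) \<longlonglongrightarrow> T"
    using assms by (auto simp: poly_limit_def)
  have app: "(\<lambda>n. poly_op (P n) A x) \<longlonglongrightarrow> T x" for x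
    by (intro blinfun.tendsto P tendsto_const)
  have "T (c *\<^sub>C x) = c *\<^sub>C T x" for c x
  proof (rule LIMSEQ_unique[OF app])
    show "(\<lambda>n. poly_op (P n) A (c *\<^sub>C x)) \<longlonglongrightarrow> c *\<^sub>C T x"
      unfolding bounded_operators_scaleC[OF poly_op_mem[OF A]]
      by (rule bounded_linear.tendsto[OF bounded_linear_scaleC app])
  qed
  then show ?thesis by (simp add: bounded_operators_iff)
qed

lemma poly_limit_norm_le:
  assumes T: "poly_limit A f T" and m: "m \<ge> 0" "\<And>z. z \<in> sp A \<Longrightarrow> cmod (f z) \<le> m"
  shows "norm T \<le> m"
proof (rule field_le_epsilon)
  fix e :: real assume e: "e > 0"
  obtain P where P: "uniform_limit (sp A) (\<lambda>n. poly (P n)) f sequentially"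
      "(\<lambda>n. poly_op (P n) A) \<longlonglongrightarrow> T"
    using T by (auto simp: poly_limit_def)
  have "\<forall>\<^sub>F n in sequentially. norm (poly_op (P n) A) \<le> m + e"
    using uniform_limitD[OF P(1) e]
  proof eventually_elim
    case (elim n)
    have "cmod (poly (P n) z) \<le> m + e" if "z \<in> sp A" for z
      using norm_triangle_sub[of "poly (P n) z" "f z"] elim[rule_format, OF that] m(2)[OF that]
      by (simp add: dist_norm)
    then show ?case
      using m(1) e by (intro norm_poly_op_le A sa real) auto
  qed
  then show "norm T \<le> m + e"
    by (intro tendsto_upperbound[OF tendsto_norm[OF P(2)]]) auto
qed

lemma poly_limit_le_norm:
  assumes T: "poly_limit A f T" and z: "z \<in> sp A"
  shows "cmod (f z) \<le> norm T"
proof -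
  obtain P where P: "uniform_limit (sp A) (\<lambda>n. poly (P n)) f sequentially"
      "(\<lambda>n. poly_op (P n) A) \<longlonglongrightarrow> T"
    using T by (auto simp: poly_limit_def)
  have "(\<lambda>n. cmod (poly (P n) z)) \<longlonglongrightarrow> cmod (f z)"
    by (intro tendsto_norm tendsto_uniform_limitI[OF P(1) z])
  then show ?thesis
    by (rule LIMSEQ_le[OF _ tendsto_norm[OF P(2)]])
      (use poly_le_norm_poly_op[OF A z] in blast)
qed

lemma poly_limit_add:
  assumes "poly_limit A f S" and "poly_limit A g T"
  shows "poly_limit A (\<lambda>z. f z + g z) (S + T)"
proof -
  obtain P Q where "uniform_limit (sp A) (\<lambda>n. poly (P n)) f sequentially"
      "(\<lambda>n. poly_op (P n) A) \<longlonglongrightarrow> S"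
      "uniform_limit (sp A) (\<lambda>n. poly (Q n)) g sequentially"
      "(\<lambda>n. poly_op (Q n) A) \<longlonglongrightarrow> T"
    using assms by (auto simp: poly_limit_def)
  then show ?thesis
    unfolding poly_limit_def
    by (intro exI[of _ "\<lambda>n. P n + Q n"]) (simp add: poly_op_add poly_add[abs_def] uniform_limit_add tendsto_add)
qed

lemma poly_limit_scaleC:
  assumes "poly_limit A f T"
  shows "poly_limit A (\<lambda>z. c * f z) (scaleC_op c T)"
proof -
  obtain P where P: "uniform_limit (sp A) (\<lambda>n. poly (P n)) f sequentially"
      "(\<lambda>n. poly_op (P n) A) \<longlonglongrightarrow> T"
    using assms by (auto simp: poly_limit_def)
  have "uniform_limit (sp A) (\<lambda>n. poly (smult c (P n))) (\<lambda>z. c * f z) sequentially"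
    using bounded_linear.uniform_limit[OF bounded_linear_mult_right P(1), of c]
    by (simp add: poly_smult[abs_def])
  moreover have "(\<lambda>n. poly_op (smult c (P n)) A) \<longlonglongrightarrow> scaleC_op c T"
    unfolding poly_op_smult[OF A]
    by (rule bounded_linear.tendsto[OF bounded_linear_scaleC_op P(2)])
  ultimately show ?thesis
    unfolding poly_limit_def by (intro exI[of _ "\<lambda>n. smult c (P n)"]) simp
qed

lemma poly_limit_mult:
  assumes "poly_limit A f S" and "poly_limit A g T"
    and "continuous_on (sp A) f" and "continuous_on (sp A) g"
  shows "poly_limit A (\<lambda>z. f z * g z) (S o\<^sub>L T)"
proof -
  obtain P Q where P: "uniform_limit (sp A) (\<lambda>n. poly (P n)) f sequentially"
      "(\<lambda>n. poly_op (P n) A) \<longlonglongrightarrow> S"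
    and Q: "uniform_limit (sp A) (\<lambda>n. poly (Q n)) g sequentially"
      "(\<lambda>n. poly_op (Q n) A) \<longlonglongrightarrow> T"
    using assms(1,2) by (auto simp: poly_limit_def)
  have "bounded (f ` sp A)" "bounded (g ` sp A)"
    using assms(3,4) by (auto intro!: compact_imp_bounded compact_continuous_image compact_sp A)
  then have "uniform_limit (sp A) (\<lambda>n z. poly (P n) z * poly (Q n) z) (\<lambda>z. f z * g z) sequentially"
    by (intro uniform_lim_mult P Q)
  moreover have "(\<lambda>n. poly_op (P n * Q n) A) \<longlonglongrightarrow> (S o\<^sub>L T)"
    unfolding poly_op_mult[OF A]
    by (intro bounded_bilinear.tendsto[OF bounded_bilinear_blinfun_compose] P Q)
  ultimately show ?thesis
    unfolding poly_limit_def by (intro exI[of _ "\<lambda>n. P n * Q n"]) (simp add: poly_mult[abs_def])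
qed

lemma poly_limit_unique:
  assumes S: "poly_limit A f S" and T: "poly_limit A f T"
  shows "S = T"
proof -
  have "poly_limit A (\<lambda>z. f z + (- 1) * f z) (S + scaleC_op (- 1) T)"
    by (intro poly_limit_add poly_limit_scaleC S T)
  then have "norm (S + scaleC_op (- 1) T) \<le> 0"
    by (rule poly_limit_norm_le) auto
  moreover have "S + scaleC_op (- 1) T = S - T"
    by (rule blinfun_eqI) (simp add: blinfun.add_left blinfun.diff_left)
  ultimately show ?thesis by simp
qed

text \<open>Uniformly Cauchy polynomials on the spectrum give a Cauchy sequence of operators, by the bound on
  the norm of \<open>(p - q)(A)\<close>.\<close>

lemma poly_op_convergent:
  assumes P: "uniform_limit (sp A) (\<lambda>n. poly (P n)) f sequentially"
  obtains T where "(\<lambda>n. poly_op (P n) A) \<longlonglongrightarrow> T"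
proof -
  have "Cauchy (\<lambda>n. poly_op (P n) A)"
  proof (rule CauchyI)
    fix e :: real assume e: "e > 0"
    then obtain N where N: "\<And>n z. n \<ge> N \<Longrightarrow> z \<in> sp A \<Longrightarrow> dist (poly (P n) z) (f z) < e / 4"
      using uniform_limitD[OF P, of "e / 4"] by (auto simp: eventually_sequentially)
    have "norm (poly_op (P m) A - poly_op (P n) A) < e" if "m \<ge> N" "n \<ge> N" for m n
    proof -
      have "cmod (poly (P m - P n) z) \<le> e / 2" if "z \<in> sp A" for z
        using N[OF \<open>m \<ge> N\<close> that] N[OF \<open>n \<ge> N\<close> that]
          dist_triangle2[of "poly (P m) z" "poly (P n) z" "f z"] by (simp add: dist_norm)
      then have "norm (poly_op (P m - P n) A) \<le> e / 2"
        using e by (intro norm_poly_op_le A sa real) auto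
      then show ?thesis using e by (simp add: poly_op_diff[OF A])
    qed
    then show "\<exists>M. \<forall>m\<ge>M. \<forall>n\<ge>M. norm (poly_op (P m) A - poly_op (P n) A) < e"
      by blast
  qed
  then show ?thesis
    using that by (auto simp: Cauchy_convergent_iff convergent_def)
qed

lemma poly_limit_adjoint:
  assumes S: "poly_limit A f S" and T: "poly_limit A (\<lambda>z. cnj (f z)) T"
  shows "is_adjoint S T"
proof -
  obtain P where P: "uniform_limit (sp A) (\<lambda>n. poly (P n)) f sequentially"
      "(\<lambda>n. poly_op (P n) A) \<longlonglongrightarrow> S"
    using S by (auto simp: poly_limit_def)
  \<comment> \<open>Only on the real line is \<open>cnj (p z)\<close> the value at \<open>z\<close> of the conjugate polynomial.\<close>
  have "cnj z = z" if "z \<in> sp A" for z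
    using that real by (auto simp: Reals_cnj_iff)
  then have cnj_P: "uniform_limit (sp A) (\<lambda>n. poly (map_poly cnj (P n))) (\<lambda>z. cnj (f z)) sequentially"
    using bounded_linear.uniform_limit[OF bounded_linear_cnj P(1)]
    by (subst uniform_limit_cong') auto
  obtain T' where T': "(\<lambda>n. poly_op (map_poly cnj (P n)) A) \<longlonglongrightarrow> T'"
    using poly_op_convergent[OF cnj_P] .
  then have "T' = T"
    using cnj_P T by (intro poly_limit_unique[of "\<lambda>z. cnj (f z)"]) (auto simp: poly_limit_def)
  have "cinner (S x) y = cinner x (T y)" for x y
  proof (rule LIMSEQ_unique)
    show "(\<lambda>n. cinner (poly_op (P n) A x) y) \<longlonglongrightarrow> cinner (S x) y"
      by (intro tendsto_cinner blinfun.tendsto P tendsto_const)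
    show "(\<lambda>n. cinner (poly_op (P n) A x) y) \<longlonglongrightarrow> cinner x (T y)"
      unfolding poly_op_adjoint[OF A sa] using T' \<open>T' = T\<close>
      by (intro tendsto_cinner blinfun.tendsto tendsto_const) auto
  qed
  then show ?thesis by (simp add: is_adjoint_def)
qed

lemma poly_limit_exists:
  assumes "continuous_on (sp A) f"
  obtains T where "poly_limit A f T"
proof -
  obtain P where P: "uniform_limit (sp A) (\<lambda>n. poly (P n)) f sequentially"
    using uniform_limit_polynomials[OF compact_sp[OF A] real assms] .
  then show ?thesis
    using poly_op_convergent[OF P] that by (metis poly_limit_def)
qed

text \<open>Uniqueness and existence of limits make \<open>poly_limit A\<close> a function on \<open>C(sp A)\<close>, and the rules above
  for \<open>poly_limit\<close> are the clauses of a functional calculus. The choice operator therefore picks some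
  functional calculus.\<close>

lemma is_functional_calculus_functional_calculus:
  "is_functional_calculus A (functional_calculus A)"
proof -
  define \<Phi> where "\<Phi> f = (THE T. poly_limit A f T)" for f
  have \<Phi>_eq: "\<Phi> f = T" if "poly_limit A f T" for f T
    unfolding \<Phi>_def using that poly_limit_unique by blast
  have \<Phi>: "poly_limit A f (\<Phi> f)" if "continuous_on (sp A) f" for f
    using poly_limit_exists[OF that] \<Phi>_eq by metis
  have norm: "norm (\<Phi> f) = Sup (insert 0 ((\<lambda>z. cmod (f z)) ` sp A))"
    if "continuous_on (sp A) f" for f
  proof (rule cSup_eq_non_empty[symmetric])
    show "x \<le> norm (\<Phi> f)" if "x \<in> insert 0 ((\<lambda>z. cmod (f z)) ` sp A)" for x
      using that poly_limit_le_norm[OF \<Phi>[OF \<open>continuous_on (sp A) f\<close>]] by auto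
    show "norm (\<Phi> f) \<le> m" if "\<And>x. x \<in> insert 0 ((\<lambda>z. cmod (f z)) ` sp A) \<Longrightarrow> x \<le> m" for m
      using that by (intro poly_limit_norm_le[OF \<Phi>[OF \<open>continuous_on (sp A) f\<close>]]) auto
  qed simp
  have one: "\<Phi> (\<lambda>z. 1) = id_blinfun"
    using \<Phi>_eq[OF poly_limit_poly[of A "[:1:]"]] by (simp add: poly_pCons[abs_def] poly_op_const del: poly_op_pCons)
  have id: "\<Phi> (\<lambda>z. z) = A"
    using \<Phi>_eq[OF poly_limit_poly[of A "[:0, 1:]"]] by (simp add: poly_pCons[abs_def] poly_op_X del: poly_op_pCons)
  have adj: "is_adjoint (\<Phi> f) (\<Phi> (\<lambda>z. cnj (f z)))" if "continuous_on (sp A) f" for f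
    by (rule poly_limit_adjoint[of f]) (intro \<Phi> continuous_intros that)+
  have "is_functional_calculus A \<Phi>"
    unfolding is_functional_calculus_def
    by (intro conjI allI impI one id norm \<Phi>_eq poly_limit_add poly_limit_mult poly_limit_scaleC
        poly_limit_mem[OF \<Phi>] adj \<Phi>)
  then show ?thesis
    unfolding functional_calculus_def by (rule someI[of "is_functional_calculus A"])
qed

end

section \<open>The quadratic form of the functional calculus\<close>

text \<open>The norm identity makes the calculus blind to values off the spectrum.\<close>

lemma functional_calculus_cong:
  assumes fc: "is_functional_calculus A \<Phi>"
    and cont: "continuous_on (sp A) f" "continuous_on (sp A) g"
    and eq: "\<And>z. z \<in> sp A \<Longrightarrow> f z = g z"
  shows "\<Phi> f = \<Phi> g"
proof -
  have cont': "continuous_on (sp A) (\<lambda>z. (- 1) * g z)"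
    by (intro continuous_intros cont)
  have "\<Phi> (\<lambda>z. f z + (- 1) * g z) = \<Phi> f + \<Phi> (\<lambda>z. (- 1) * g z)"
    using fc cont(1) cont' unfolding is_functional_calculus_def by blast
  also have "\<Phi> (\<lambda>z. (- 1) * g z) = scaleC_op (- 1) (\<Phi> g)"
    using fc cont(2) unfolding is_functional_calculus_def by blast
  also have "scaleC_op (- 1) (\<Phi> g) = - \<Phi> g"
    by (rule blinfun_eqI) (simp add: blinfun.minus_left)
  finally have diff: "\<Phi> (\<lambda>z. f z + (- 1) * g z) = \<Phi> f - \<Phi> g"
    by simp
  have "norm (\<Phi> (\<lambda>z. f z + (- 1) * g z))
      = Sup (insert 0 ((\<lambda>z. cmod (f z + (- 1) * g z)) ` sp A))"
    using fc continuous_on_add[OF cont(1) cont'] unfolding is_functional_calculus_def by blast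
  also have "insert 0 ((\<lambda>z. cmod (f z + (- 1) * g z)) ` sp A) = {0}"
    using eq by auto
  finally have "norm (\<Phi> f - \<Phi> g) = 0"
    unfolding diff by simp
  then show ?thesis by simp
qed

context
  fixes A :: "'a::complex_hilbert_space \<Rightarrow>\<^sub>L 'a" and a b :: real
  assumes A: "A \<in> bounded_operators" and sa: "selfadjoint A"
    and sp: "sp A \<subseteq> complex_of_real ` {a..b}"
begin

lemma functional_calculus: "is_functional_calculus A (functional_calculus A)"
  using sp by (intro is_functional_calculus_functional_calculus A sa) auto

lemma continuous_on_sp:
  assumes "continuous_on {a..b} u"
  shows "continuous_on (sp A) (\<lambda>z. complex_of_real (u (Re z)))"
  by (intro continuous_on_of_real continuous_on_compose2[OF assms])
    (use sp in \<open>auto intro!: continuous_intros\<close>)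

lemma apply_real_fun_add:
  assumes "continuous_on {a..b} u" and "continuous_on {a..b} v"
  shows "apply_real_fun (\<lambda>t. u t + v t) A = apply_real_fun u A + apply_real_fun v A"
  using functional_calculus assms[THEN continuous_on_sp]
  unfolding is_functional_calculus_def apply_real_fun_def of_real_add by blast

lemma apply_real_fun_mult:
  assumes "continuous_on {a..b} u" and "continuous_on {a..b} v"
  shows "apply_real_fun (\<lambda>t. u t * v t) A = apply_real_fun u A o\<^sub>L apply_real_fun v A"
  using functional_calculus assms[THEN continuous_on_sp]
  unfolding is_functional_calculus_def apply_real_fun_def of_real_mult by blast

lemma apply_real_fun_scale:
  assumes "continuous_on {a..b} u"
  shows "apply_real_fun (\<lambda>t. c * u t) A = scaleC_op (complex_of_real c) (apply_real_fun u A)"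
  using functional_calculus assms[THEN continuous_on_sp]
  unfolding is_functional_calculus_def apply_real_fun_def of_real_mult by blast

lemma apply_real_fun_selfadjoint:
  assumes "continuous_on {a..b} u"
  shows "cinner (apply_real_fun u A x) y = cinner x (apply_real_fun u A y)"
proof -
  have "is_adjoint (apply_real_fun u A)
      (functional_calculus A (\<lambda>z. cnj (complex_of_real (u (Re z)))))"
    using functional_calculus assms[THEN continuous_on_sp]
    unfolding is_functional_calculus_def apply_real_fun_def by blast
  then show ?thesis
    by (simp add: is_adjoint_def apply_real_fun_def)
qed

lemma apply_real_fun_form_real:
  assumes "continuous_on {a..b} u"
  shows "Im (cinner (apply_real_fun u A x) x) = 0"
proof -
  have "cnj (cinner (apply_real_fun u A x) x) = cinner (apply_real_fun u A x) x"
    by (metis cinner_commute apply_real_fun_selfadjoint[OF assms])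
  then show ?thesis
    by (simp add: complex_eq_iff)
qed

text \<open>With \<open>r = sqrt u\<close> the form is \<open>(norm (r(A) x))\<^sup>2\<close>. Here \<open>r\<^sup>2 = u\<close> only where \<open>u \<ge> 0\<close>, hence the
  appeal to values on the spectrum alone.\<close>

lemma apply_real_fun_form_nonneg:
  assumes u: "continuous_on {a..b} u" and nonneg: "\<And>t. t \<in> {a..b} \<Longrightarrow> u t \<ge> 0"
  shows "Re (cinner (apply_real_fun u A x) x) \<ge> 0"
proof -
  let ?r = "\<lambda>t. sqrt (u t)"
  have r: "continuous_on {a..b} ?r"
    by (intro continuous_intros u)
  have "apply_real_fun u A = apply_real_fun ?r A o\<^sub>L apply_real_fun ?r A"
    unfolding apply_real_fun_mult[OF r r, symmetric] unfolding apply_real_fun_def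
  proof (rule functional_calculus_cong[OF functional_calculus])
    show "continuous_on (sp A) (\<lambda>z. complex_of_real (u (Re z)))"
      and "continuous_on (sp A) (\<lambda>z. complex_of_real (?r (Re z) * ?r (Re z)))"
      by (intro continuous_on_sp continuous_on_mult u r)+
    show "complex_of_real (u (Re z)) = complex_of_real (?r (Re z) * ?r (Re z))" if "z \<in> sp A" for z
      using sp that nonneg by auto
  qed
  then have "cinner (apply_real_fun u A x) x
      = cinner (apply_real_fun ?r A x) (apply_real_fun ?r A x)"
    by (simp add: apply_real_fun_selfadjoint[OF r])
  then show ?thesis
    by (simp add: cinner_self_norm)
qed

end

section \<open>The inequality for positive linear functionals\<close>

text \<open>This is Andreief's argument for Chebyshev's inequality. The product in the definition of
  synchrony, read as a function of one variable with the other fixed, is non-negative, and so is the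
  value of the functional at it. That value, as a function of the variable that was fixed, is a
  linear combination of \<open>h\<^sup>2\<close>, \<open>h g\<close>, \<open>h f\<close> and \<open>f g\<close>; applying the functional once more yields twice
  the difference of the two sides.\<close>

lemma synchronous_positive_functional:
  fixes E :: "(real \<Rightarrow> real) \<Rightarrow> real"
  assumes add: "\<And>u v. continuous_on S u \<Longrightarrow> continuous_on S v \<Longrightarrow> E (\<lambda>t. u t + v t) = E u + E v"
    and scale: "\<And>c u. continuous_on S u \<Longrightarrow> E (\<lambda>t. c * u t) = c * E u"
    and pos: "\<And>u. continuous_on S u \<Longrightarrow> (\<And>t. t \<in> S \<Longrightarrow> u t \<ge> 0) \<Longrightarrow> E u \<ge> 0"
    and h: "continuous_on S h" and f: "continuous_on S f" and g: "continuous_on S g"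
    and sync: "h_synchronous_on S h f g"
  shows "E (\<lambda>t. h t * g t) * E (\<lambda>t. h t * f t) \<le> E (\<lambda>t. (h t)\<^sup>2) * E (\<lambda>t. f t * g t)"
proof -
  define ff where "ff = (\<lambda>t. f t * g t)"
  define hf where "hf = (\<lambda>t. h t * f t)"
  define hg where "hg = (\<lambda>t. h t * g t)"
  define hh where "hh = (\<lambda>t. (h t)\<^sup>2)"
  note defs = ff_def hf_def hg_def hh_def
  have cont: "continuous_on S ff" "continuous_on S hf" "continuous_on S hg" "continuous_on S hh"
    unfolding defs by (intro continuous_intros h f g)+
  have lin: "E (\<lambda>t. p * ff t + q * hf t + r * hg t + s * hh t)
      = p * E ff + q * E hf + r * E hg + s * E hh" for p q r s
    by (simp add: add scale cont continuous_on_add continuous_on_mult_left)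
  have once: "(h s)\<^sup>2 * E ff - hg s * E hf - hf s * E hg + ff s * E hh \<ge> 0" if s: "s \<in> S" for s
  proof -
    have "0 \<le> E (\<lambda>t. (h s)\<^sup>2 * ff t + (- hg s) * hf t + (- hf s) * hg t + ff s * hh t)"
    proof (rule pos)
      fix t assume t: "t \<in> S"
      have "0 \<le> (h s * f t - h t * f s) * (h s * g t - h t * g s)"
        using sync s t by (simp add: h_synchronous_on_def)
      also have "\<dots> = (h s)\<^sup>2 * ff t + (- hg s) * hf t + (- hf s) * hg t + ff s * hh t"
        by (simp add: defs power2_eq_square algebra_simps)
      finally show "0 \<le> (h s)\<^sup>2 * ff t + (- hg s) * hf t + (- hf s) * hg t + ff s * hh t" .
    qed (intro continuous_intros cont)
    then show ?thesis unfolding lin by simp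
  qed
  have "0 \<le> E (\<lambda>t. E hh * ff t + (- E hg) * hf t + (- E hf) * hg t + E ff * hh t)"
  proof (rule pos)
    fix s assume "s \<in> S"
    from once[OF this]
    show "0 \<le> E hh * ff s + (- E hg) * hf s + (- E hf) * hg s + E ff * hh s"
      by (simp add: hh_def algebra_simps)
  qed (intro continuous_intros cont)
  also have "\<dots> = 2 * (E hh * E ff - E hg * E hf)"
    unfolding lin by (simp add: algebra_simps)
  finally show ?thesis
    by (simp add: defs)
qed

lemma h_asynchronous_on_iff: "h_asynchronous_on S h f g \<longleftrightarrow> h_synchronous_on S h f (\<lambda>t. - g t)"
proof -
  have "(h y * f x - h x * f y) * (h y * - g x - h x * - g y)
      = - ((h y * f x - h x * f y) * (h y * g x - h x * g y))" for x y
    by (simp add: algebra_simps)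
  then show ?thesis
    by (simp only: h_asynchronous_on_def h_synchronous_on_def neg_0_le_iff_le)
qed

theorem theorem2p7:
  fixes A :: "'a::complex_hilbert_space \<Rightarrow>\<^sub>L 'a"
    and \<gamma> \<Gamma> :: real
    and h f g :: "real \<Rightarrow> real"
  assumes "A \<in> bounded_operators" and "selfadjoint A"
    and "\<gamma> < \<Gamma>" and "sp A \<subseteq> complex_of_real ` {\<gamma>..\<Gamma>}"
    and "\<forall>t\<in>{\<gamma>..\<Gamma>}. h t \<ge> 0"
    and "continuous_on {\<gamma>..\<Gamma>} h"
    and "continuous_on {\<gamma>..\<Gamma>} f"
    and "continuous_on {\<gamma>..\<Gamma>} g"
  shows "(h_synchronous_on {\<gamma>..\<Gamma>} h f g \<longrightarrow>
      (\<forall>x. norm x = 1 \<longrightarrow>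
        cinner (apply_real_fun (\<lambda>t. (h t)\<^sup>2) A x) x *
        cinner ((apply_real_fun f A o\<^sub>L apply_real_fun g A) x) x
        \<ge> cinner ((apply_real_fun h A o\<^sub>L apply_real_fun g A) x) x *
          cinner ((apply_real_fun h A o\<^sub>L apply_real_fun f A) x) x))
    \<and> (h_asynchronous_on {\<gamma>..\<Gamma>} h f g \<longrightarrow>
      (\<forall>x. norm x = 1 \<longrightarrow>
        cinner (apply_real_fun (\<lambda>t. (h t)\<^sup>2) A x) x *
        cinner ((apply_real_fun f A o\<^sub>L apply_real_fun g A) x) x
        \<le> cinner ((apply_real_fun h A o\<^sub>L apply_real_fun g A) x) x *
          cinner ((apply_real_fun h A o\<^sub>L apply_real_fun f A) x) x))"
proof -
  note sp = \<open>sp A \<subseteq> complex_of_real ` {\<gamma>..\<Gamma>}\<close>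
  note op = \<open>A \<in> bounded_operators\<close> \<open>selfadjoint A\<close> sp
  note h = \<open>continuous_on {\<gamma>..\<Gamma>} h\<close> and f = \<open>continuous_on {\<gamma>..\<Gamma>} f\<close> and g = \<open>continuous_on {\<gamma>..\<Gamma>} g\<close>
  define E where "E x u = Re (cinner (apply_real_fun u A x) x)" for x u
  have form: "cinner (apply_real_fun u A x) x = complex_of_real (E x u)"
    if "continuous_on {\<gamma>..\<Gamma>} u" for u x
    using apply_real_fun_form_real[OF op that] by (simp add: E_def complex_eq_iff)
  have add: "E x (\<lambda>t. u t + v t) = E x u + E x v"
    if "continuous_on {\<gamma>..\<Gamma>} u" "continuous_on {\<gamma>..\<Gamma>} v" for x u v
    by (simp add: E_def apply_real_fun_add[OF op that] blinfun.add_left cinner_add_left)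
  have scale: "E x (\<lambda>t. c * u t) = c * E x u" if "continuous_on {\<gamma>..\<Gamma>} u" for x c u
    by (simp add: E_def apply_real_fun_scale[OF op that] cinner_scaleC_left)
  have pos: "E x u \<ge> 0" if "continuous_on {\<gamma>..\<Gamma>} u" "\<And>t. t \<in> {\<gamma>..\<Gamma>} \<Longrightarrow> u t \<ge> 0" for x u
    unfolding E_def by (rule apply_real_fun_form_nonneg[OF op that])
  have sync: "E x (\<lambda>t. h t * k t) * E x (\<lambda>t. h t * f t) \<le> E x (\<lambda>t. (h t)\<^sup>2) * E x (\<lambda>t. f t * k t)"
    if "continuous_on {\<gamma>..\<Gamma>} k" and "h_synchronous_on {\<gamma>..\<Gamma>} h f k" for x k
    by (rule synchronous_positive_functional[of "{\<gamma>..\<Gamma>}" "E x", OF add scale pos h f that])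
  have prods: "continuous_on {\<gamma>..\<Gamma>} (\<lambda>t. (h t)\<^sup>2)" "continuous_on {\<gamma>..\<Gamma>} (\<lambda>t. f t * g t)"
    "continuous_on {\<gamma>..\<Gamma>} (\<lambda>t. h t * g t)" "continuous_on {\<gamma>..\<Gamma>} (\<lambda>t. h t * f t)"
    by (intro continuous_intros h f g)+
  have forms: "cinner (apply_real_fun (\<lambda>t. (h t)\<^sup>2) A x) x = complex_of_real (E x (\<lambda>t. (h t)\<^sup>2))"
    "cinner ((apply_real_fun f A o\<^sub>L apply_real_fun g A) x) x = complex_of_real (E x (\<lambda>t. f t * g t))"
    "cinner ((apply_real_fun h A o\<^sub>L apply_real_fun g A) x) x = complex_of_real (E x (\<lambda>t. h t * g t))"
    "cinner ((apply_real_fun h A o\<^sub>L apply_real_fun f A) x) x = complex_of_real (E x (\<lambda>t. h t * f t))"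
    for x
    unfolding apply_real_fun_mult[OF op f g, symmetric] apply_real_fun_mult[OF op h g, symmetric]
      apply_real_fun_mult[OF op h f, symmetric]
    by (rule form[OF prods(1)] form[OF prods(2)] form[OF prods(3)] form[OF prods(4)])+
  have "E x (\<lambda>t. h t * g t) * E x (\<lambda>t. h t * f t) \<le> E x (\<lambda>t. (h t)\<^sup>2) * E x (\<lambda>t. f t * g t)"
    if "h_synchronous_on {\<gamma>..\<Gamma>} h f g" for x
    by (rule sync[OF g that])
  moreover have "E x (\<lambda>t. (h t)\<^sup>2) * E x (\<lambda>t. f t * g t) \<le> E x (\<lambda>t. h t * g t) * E x (\<lambda>t. h t * f t)"
    if "h_asynchronous_on {\<gamma>..\<Gamma>} h f g" for x
  proof -
    have "E x (\<lambda>t. h t * - g t) * E x (\<lambda>t. h t * f t) \<le> E x (\<lambda>t. (h t)\<^sup>2) * E x (\<lambda>t. f t * - g t)"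
      using that unfolding h_asynchronous_on_iff by (rule sync[OF continuous_on_minus[OF g]])
    then show ?thesis
      using scale[OF prods(3), of x "- 1"] scale[OF prods(2), of x "- 1"] by simp
  qed
  ultimately show ?thesis
    unfolding forms by (simp add: less_eq_complex_def)
qed

end
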